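(* Let $\mathcal E\colon L^2(\mu)\to[0,\infty]$ be a lower semicontinuous convex functional with $\mathcal E(-f)=\mathcal E(f)$ for all $f$ and $\mathcal E(0)=0$. Assume one of the following two conditions: (A) $(M(\mathcal E),\|\cdot\|_L)$ is a Banach space; (B) $\mathcal E$ is a nonlinear Dirichlet form. Then the extended functional $\mathcal E_e$ exists, i.e. $\mathcal E$ (extended by $+\infty$ to $L^0(\mu)\setminus L^2(\mu)$) is lower semicontinuous on $D(\mathcal E)$ with respect to local convergence in measure. If (A) holds, then $\mathcal E=\mathcal E_e$, where $\mathcal E$ is regarded as a functional on $L^0(\mu)$ by setting it equal to $+\infty$ outside $L^2(\mu)$.
   Context: Let $(X,\mathfrak A,\mu)$ be a $\sigma$-finite measure space; $L^2(\mu)$ is the Hilbert space of real square integrable functions and $L^0(\mu)$ the space of (classes of) real measurable functions with the topology of local convergence in measure ($f_n\to f$ iff every subsequence has a further subsequence converging $\mu$-a.e. to $f$). $D(\mathcal E)=\{f:\mathcal E(f)<\infty\}$. The modular space is $M(\mathcal E)=\{f\in L^2(\mu): \lim_{\lambda\to0+}\mathcal E(\lambda f)=0\}$ (the linear hull of $D(\mathcal E)$), with Luxemburg seminorm $\|f\|_L=\inf\{\lambda>0:\mathcal E(\lambda^{-1}f)\le 1\}$. A normal contraction is a 1-Lipschitz $C\colon\mathbb R\to\mathbb R$ with $C(0)=0$; it operates on $\mathcal E$ if $\mathcal E(f+Cg)+\mathcal E(f-Cg)\le\mathcal E(f+g)+\mathcal E(f-g)$ for all $f,g$. A nonlinear Dirichlet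 form is a proper lower semicontinuous convex functional $\mathcal E\colon L^2(\mu)\to[0,\infty]$ (here symmetric with $\mathcal E(0)=0$) on which every normal contraction operates. If $\mathcal E$, extended by $+\infty$ to $L^0(\mu)$, satisfies $\mathcal E(f)\le\liminf\mathcal E(f_n)$ whenever $f_n,f\in D(\mathcal E)$ and $f_n\to f$ locally in measure, then its lower semicontinuous relaxation on $L^0(\mu)$ (the largest minorant that is lower semicontinuous for local convergence in measure) extends $\mathcal E$ and is denoted $\mathcal E_e$; in this case one says $\mathcal E_e$ exists. *)

theory Defs
  imports "HOL-Analysis.Analysis"
begin

text \<open>Real functions on the measure space; classes modulo a.e. equality are represented
  by functions, and functionals are required to respect a.e. equality.\<close>

definition L2 :: "'a measure \<Rightarrow> ('a \<Rightarrow> real) set" where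
  "L2 M = {f. f \<in> borel_measurable M \<and> integrable M (\<lambda>x. (f x)\<^sup>2)}"

definition L2_norm :: "'a measure \<Rightarrow> ('a \<Rightarrow> real) \<Rightarrow> real" where
  "L2_norm M f = sqrt (\<integral>x. (f x)\<^sup>2 \<partial>M)"

definition loc_meas_conv :: "'a measure \<Rightarrow> (nat \<Rightarrow> 'a \<Rightarrow> real) \<Rightarrow> ('a \<Rightarrow> real) \<Rightarrow> bool" where
  "loc_meas_conv M fs f \<longleftrightarrow>
     (\<forall>r::nat \<Rightarrow> nat. strict_mono r \<longrightarrow>
        (\<exists>s::nat \<Rightarrow> nat. strict_mono s \<and> (AE x in M. (\<lambda>n. fs (r (s n)) x) \<longlonglongrightarrow> f x)))"

definition respects_ae :: "'a measure \<Rightarrow> (('a \<Rightarrow> real) \<Rightarrow> ennreal) \<Rightarrow> bool" where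
  "respects_ae M E \<longleftrightarrow>
     (\<forall>f\<in>L2 M. \<forall>g\<in>L2 M. (AE x in M. f x = g x) \<longrightarrow> E f = E g)"

definition lsc_L2 :: "'a measure \<Rightarrow> (('a \<Rightarrow> real) \<Rightarrow> ennreal) \<Rightarrow> bool" where
  "lsc_L2 M E \<longleftrightarrow>
     (\<forall>fs f. (\<forall>n. fs n \<in> L2 M) \<longrightarrow> f \<in> L2 M \<longrightarrow>
        (\<lambda>n. L2_norm M (\<lambda>x. fs n x - f x)) \<longlonglongrightarrow> 0 \<longrightarrow>
        E f \<le> liminf (\<lambda>n. E (fs n)))"

definition convex_L2 :: "'a measure \<Rightarrow> (('a \<Rightarrow> real) \<Rightarrow> ennreal) \<Rightarrow> bool" where
  "convex_L2 M E \<longleftrightarrow>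
     (\<forall>f\<in>L2 M. \<forall>g\<in>L2 M. \<forall>t::real. 0 \<le> t \<longrightarrow> t \<le> 1 \<longrightarrow>
        E (\<lambda>x. t * f x + (1 - t) * g x) \<le> ennreal t * E f + ennreal (1 - t) * E g)"

definition dom_E :: "'a measure \<Rightarrow> (('a \<Rightarrow> real) \<Rightarrow> ennreal) \<Rightarrow> ('a \<Rightarrow> real) set" where
  "dom_E M E = {f \<in> L2 M. E f < \<infinity>}"

definition normal_contraction :: "(real \<Rightarrow> real) \<Rightarrow> bool" where
  "normal_contraction C \<longleftrightarrow> (\<forall>x y. \<bar>C x - C y\<bar> \<le> \<bar>x - y\<bar>) \<and> C 0 = 0"

definition operates_on :: "'a measure \<Rightarrow> (real \<Rightarrow> real) \<Rightarrow> (('a \<Rightarrow> real) \<Rightarrow> ennreal) \<Rightarrow> bool" where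
  "operates_on M C E \<longleftrightarrow>
     (\<forall>f\<in>L2 M. \<forall>g\<in>L2 M.
        E (\<lambda>x. f x + C (g x)) + E (\<lambda>x. f x - C (g x)) \<le> E (\<lambda>x. f x + g x) + E (\<lambda>x. f x - g x))"

definition nonlinear_dirichlet_form :: "'a measure \<Rightarrow> (('a \<Rightarrow> real) \<Rightarrow> ennreal) \<Rightarrow> bool" where
  "nonlinear_dirichlet_form M E \<longleftrightarrow>
     dom_E M E \<noteq> {} \<and> lsc_L2 M E \<and> convex_L2 M E \<and>
     (\<forall>C. normal_contraction C \<longrightarrow> operates_on M C E)"

definition modular_space :: "'a measure \<Rightarrow> (('a \<Rightarrow> real) \<Rightarrow> ennreal) \<Rightarrow> ('a \<Rightarrow> real) set" where
  "modular_space M E =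
     {f \<in> L2 M. ((\<lambda>l::real. E (\<lambda>x. l * f x)) \<longlongrightarrow> 0) (at_right 0)}"

definition luxemburg :: "(('a \<Rightarrow> real) \<Rightarrow> ennreal) \<Rightarrow> ('a \<Rightarrow> real) \<Rightarrow> real" where
  "luxemburg E f = Inf {l::real. l > 0 \<and> E (\<lambda>x. f x / l) \<le> 1}"

definition modular_banach :: "'a measure \<Rightarrow> (('a \<Rightarrow> real) \<Rightarrow> ennreal) \<Rightarrow> bool" where
  "modular_banach M E \<longleftrightarrow>
     (\<forall>f\<in>modular_space M E. luxemburg E f = 0 \<longrightarrow> (AE x in M. f x = 0)) \<and>
     (\<forall>fs. (\<forall>n. fs n \<in> modular_space M E) \<longrightarrow>
        (\<forall>e>0. \<exists>N. \<forall>m\<ge>N. \<forall>n\<ge>N. luxemburg E (\<lambda>x. fs m x - fs n x) < e) \<longrightarrow>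
        (\<exists>f\<in>modular_space M E. (\<lambda>n. luxemburg E (\<lambda>x. fs n x - f x)) \<longlonglongrightarrow> 0))"

definition ext_L0 :: "'a measure \<Rightarrow> (('a \<Rightarrow> real) \<Rightarrow> ennreal) \<Rightarrow> ('a \<Rightarrow> real) \<Rightarrow> ennreal" where
  "ext_L0 M E f = (if f \<in> L2 M then E f else \<infinity>)"

text \<open>Sequential lower semicontinuity on L0 w.r.t. local convergence in measure
  (the topology is metrizable for sigma-finite measures).\<close>
definition lsc_L0 :: "'a measure \<Rightarrow> (('a \<Rightarrow> real) \<Rightarrow> ennreal) \<Rightarrow> bool" where
  "lsc_L0 M F \<longleftrightarrow>
     (\<forall>fs f. (\<forall>n. fs n \<in> borel_measurable M) \<longrightarrow> f \<in> borel_measurable M \<longrightarrow>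
        loc_meas_conv M fs f \<longrightarrow> F f \<le> liminf (\<lambda>n. F (fs n)))"

definition relaxation_L0 :: "'a measure \<Rightarrow> (('a \<Rightarrow> real) \<Rightarrow> ennreal) \<Rightarrow> ('a \<Rightarrow> real) \<Rightarrow> ennreal" where
  "relaxation_L0 M F f =
     (SUP G \<in> {G. lsc_L0 M G \<and> (\<forall>g\<in>borel_measurable M. G g \<le> F g)}. G f)"

definition E_e_exists :: "'a measure \<Rightarrow> (('a \<Rightarrow> real) \<Rightarrow> ennreal) \<Rightarrow> bool" where
  "E_e_exists M E \<longleftrightarrow>
     (\<forall>fs f. (\<forall>n. fs n \<in> dom_E M E) \<longrightarrow> f \<in> dom_E M E \<longrightarrow> loc_meas_conv M fs f \<longrightarrow>
        ext_L0 M E f \<le> liminf (\<lambda>n. ext_L0 M E (fs n)))"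

end

theory Submission
  imports Defs
begin

text \<open>If the modular space is complete, its embedding into \<open>L\<^sup>2\<close> has a closed graph by lower
  semicontinuity and is therefore bounded, so sublevel sets of the functional are bounded in
  \<open>L\<^sup>2\<close>. A bounded sequence converging almost everywhere has convex combinations converging in
  norm, and convexity with lower semicontinuity in \<open>L\<^sup>2\<close> concludes.

  For a Dirichlet form, choose \<open>g \<ge> |f|\<close> whose energy is minimal up to \<open>\<epsilon>\<close> among all majorants of
  \<open>|f|\<close>. The inequality \<open>E (u \<or> g) + E (u \<and> g) \<le> E u + E g\<close> and \<open>E (u \<or> g) \<ge> E g - \<epsilon>\<close> show that
  truncating at \<open>g\<close> from above and at \<open>- g\<close> from below costs at most \<open>2 \<epsilon>\<close>, and the truncations
  of an almost everywhere convergent sequence converge in \<open>L\<^sup>2\<close> by dominated convergence.\<close>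

section \<open>Square integrable functions\<close>

lemma L2_measurable [measurable_dest]: "f \<in> L2 M \<Longrightarrow> f \<in> borel_measurable M"
  by (simp add: L2_def)

lemma L2_square_integrable: "f \<in> L2 M \<Longrightarrow> integrable M (\<lambda>x. (f x)\<^sup>2)"
  by (simp add: L2_def)

lemma L2_norm_nonneg [simp]: "0 \<le> L2_norm M f"
  by (simp add: L2_norm_def)

lemma L2_norm_square: "(L2_norm M f)\<^sup>2 = (\<integral>x. (f x)\<^sup>2 \<partial>M)"
  by (simp add: L2_norm_def)

lemma L2_dominated:
  assumes "g \<in> L2 M" "f \<in> borel_measurable M" "\<And>x. \<bar>f x\<bar> \<le> \<bar>g x\<bar>"
  shows "f \<in> L2 M"
proof -
  have "integrable M (\<lambda>x. (f x)\<^sup>2)"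
  proof (rule Bochner_Integration.integrable_bound[OF L2_square_integrable[OF assms(1)]])
    show "AE x in M. norm ((f x)\<^sup>2) \<le> norm ((g x)\<^sup>2)"
      using assms(3) by (auto simp: abs_le_square_iff)
  qed (use assms in measurable)
  then show ?thesis using assms(2) by (simp add: L2_def)
qed

lemma L2_zero: "(\<lambda>x. 0) \<in> L2 M"
  by (simp add: L2_def)

lemma L2_scale: "f \<in> L2 M \<Longrightarrow> (\<lambda>x. c * f x) \<in> L2 M"
  by (auto simp: L2_def power_mult_distrib)

lemma L2_add:
  assumes "f \<in> L2 M" "g \<in> L2 M"
  shows "(\<lambda>x. f x + g x) \<in> L2 M"
proof -
  note [measurable] = assms[THEN L2_measurable]
  have "integrable M (\<lambda>x. 2 * (f x)\<^sup>2 + 2 * (g x)\<^sup>2)"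
    using assms by (auto simp: L2_def)
  then have "integrable M (\<lambda>x. (f x + g x)\<^sup>2)"
  proof (rule Bochner_Integration.integrable_bound)
    have "(a + b)\<^sup>2 \<le> 2 * a\<^sup>2 + 2 * b\<^sup>2" for a b :: real
      using sum_squares_bound[of a b] by (simp add: power2_sum)
    then show "AE x in M. norm ((f x + g x)\<^sup>2) \<le> norm (2 * (f x)\<^sup>2 + 2 * (g x)\<^sup>2)"
      by auto
  qed measurable
  then show ?thesis by (simp add: L2_def)
qed

lemma L2_minus: "f \<in> L2 M \<Longrightarrow> (\<lambda>x. - f x) \<in> L2 M"
  using L2_scale[of f M "-1"] by simp

lemma L2_diff: "f \<in> L2 M \<Longrightarrow> g \<in> L2 M \<Longrightarrow> (\<lambda>x. f x - g x) \<in> L2 M"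
  using L2_add[OF _ L2_minus] by simp

lemma L2_divide: "f \<in> L2 M \<Longrightarrow> (\<lambda>x. f x / c) \<in> L2 M"
  using L2_scale[of f M "1 / c"] by simp

lemma L2_abs: "f \<in> L2 M \<Longrightarrow> (\<lambda>x. \<bar>f x\<bar>) \<in> L2 M"
  by (rule L2_dominated) auto

lemma L2_sum: "(\<And>i. i \<in> I \<Longrightarrow> fs i \<in> L2 M) \<Longrightarrow> (\<lambda>x. \<Sum>i\<in>I. fs i x) \<in> L2 M"
  by (induction I rule: infinite_finite_induct) (auto simp: L2_zero intro: L2_add)

lemma L2_norm_minus: "L2_norm M (\<lambda>x. - f x) = L2_norm M f"
  by (simp add: L2_norm_def)

lemma L2_norm_scale: "L2_norm M (\<lambda>x. c * f x) = \<bar>c\<bar> * L2_norm M f"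
  by (simp add: L2_norm_def power_mult_distrib real_sqrt_mult)

text \<open>Weighted AM-GM gives \<open>(f + g)^2 <= (1 + q/p) * f^2 + (1 + p/q) * g^2\<close>
  pointwise, and the integral of the right side is at most \<open>(p + q)^2\<close>. Taking
  \<open>p\<close> and \<open>q\<close> strictly above the norms keeps the weights meaningful when a
  norm vanishes.\<close>

lemma L2_norm_triangle:
  assumes "f \<in> L2 M" "g \<in> L2 M"
  shows "L2_norm M (\<lambda>x. f x + g x) \<le> L2_norm M f + L2_norm M g"
proof -
  have bound: "L2_norm M (\<lambda>x. f x + g x) \<le> p + q"
    if pq: "L2_norm M f < p" "L2_norm M g < q" for p q
  proof -
    have pos: "p > 0" "q > 0" using pq L2_norm_nonneg le_less_trans by blast+
    have int: "integrable M (\<lambda>x. (1 + q / p) * (f x)\<^sup>2 + (1 + p / q) * (g x)\<^sup>2)"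
      using assms by (auto simp: L2_def)
    have "(L2_norm M (\<lambda>x. f x + g x))\<^sup>2
      \<le> (\<integral>x. (1 + q / p) * (f x)\<^sup>2 + (1 + p / q) * (g x)\<^sup>2 \<partial>M)"
      unfolding L2_norm_square
    proof (rule integral_mono[OF L2_square_integrable[OF L2_add[OF assms]] int])
      fix x
      have "0 \<le> (q * f x - p * g x)\<^sup>2 / (p * q)" using pos by simp
      also have "\<dots> = q / p * (f x)\<^sup>2 + p / q * (g x)\<^sup>2 - 2 * f x * g x"
        using pos by (simp add: field_simps power2_eq_square)
      finally show "(f x + g x)\<^sup>2 \<le> (1 + q / p) * (f x)\<^sup>2 + (1 + p / q) * (g x)\<^sup>2"
        by (simp add: power2_sum algebra_simps)
    qed
    also have "\<dots> = (1 + q / p) * (L2_norm M f)\<^sup>2 + (1 + p / q) * (L2_norm M g)\<^sup>2"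
      using assms by (simp add: L2_norm_square L2_def)
    also have "\<dots> \<le> (1 + q / p) * p\<^sup>2 + (1 + p / q) * q\<^sup>2"
      using pq pos by (intro add_mono mult_left_mono power_mono) (auto intro: less_imp_le)
    also have "\<dots> = (p + q)\<^sup>2" using pos by (simp add: field_simps power2_eq_square)
    finally show ?thesis using pos by (auto intro: power2_le_imp_le)
  qed
  show ?thesis
  proof (rule field_le_epsilon)
    fix e :: real assume "e > 0"
    then show "L2_norm M (\<lambda>x. f x + g x) \<le> L2_norm M f + L2_norm M g + e"
      using bound[of "L2_norm M f + e / 2" "L2_norm M g + e / 2"] by simp
  qed
qed

lemma L2_norm_triangle_diff:
  assumes "f \<in> L2 M" "g \<in> L2 M"
  shows "L2_norm M (\<lambda>x. f x - g x) \<le> L2_norm M f + L2_norm M g"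
  using L2_norm_triangle[OF assms(1) L2_minus[OF assms(2)]] by (simp add: L2_norm_minus)

lemma L2_norm_sum:
  assumes "\<And>i. i \<in> I \<Longrightarrow> fs i \<in> L2 M"
  shows "L2_norm M (\<lambda>x. \<Sum>i\<in>I. fs i x) \<le> (\<Sum>i\<in>I. L2_norm M (fs i))"
  using assms
proof (induction I rule: infinite_finite_induct)
  case (insert i I)
  have "L2_norm M (\<lambda>x. fs i x + (\<Sum>i\<in>I. fs i x))
      \<le> L2_norm M (fs i) + L2_norm M (\<lambda>x. \<Sum>i\<in>I. fs i x)"
    using insert by (intro L2_norm_triangle L2_sum) auto
  also have "\<dots> \<le> L2_norm M (fs i) + (\<Sum>i\<in>I. L2_norm M (fs i))"
    using insert by auto
  finally show ?case using insert by simp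
qed (auto simp: L2_norm_def)

text \<open>Written with the midpoint because midpoints stay in convex sets: almost minimal elements
  of such a set are then close to each other.\<close>

lemma L2_norm_parallelogram:
  assumes "f \<in> L2 M" "g \<in> L2 M"
  shows "(L2_norm M (\<lambda>x. f x - g x))\<^sup>2
    = 2 * (L2_norm M f)\<^sup>2 + 2 * (L2_norm M g)\<^sup>2 - 4 * (L2_norm M (\<lambda>x. (f x + g x) / 2))\<^sup>2"
proof -
  have *: "(L2_norm M (\<lambda>x. f x - g x))\<^sup>2
    = (\<integral>x. (2 * (f x)\<^sup>2 + 2 * (g x)\<^sup>2) - 4 * ((f x + g x) / 2)\<^sup>2 \<partial>M)"
    unfolding L2_norm_square
    by (intro Bochner_Integration.integral_cong) (auto simp: power2_eq_square field_simps)
  have "integrable M (\<lambda>x. ((f x + g x) / 2)\<^sup>2)"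
    using assms by (intro L2_square_integrable L2_divide L2_add)
  then have "integrable M (\<lambda>x. 4 * ((f x + g x) / 2)\<^sup>2)"
    by (rule integrable_mult_right)
  moreover have "integrable M (\<lambda>x. 2 * (f x)\<^sup>2 + 2 * (g x)\<^sup>2)"
    using assms by (auto simp: L2_def)
  ultimately have "(L2_norm M (\<lambda>x. f x - g x))\<^sup>2
    = (\<integral>x. 2 * (f x)\<^sup>2 + 2 * (g x)\<^sup>2 \<partial>M) - (\<integral>x. 4 * ((f x + g x) / 2)\<^sup>2 \<partial>M)"
    unfolding * by (rule Bochner_Integration.integral_diff[rotated])
  also have "\<dots> = 2 * (L2_norm M f)\<^sup>2 + 2 * (L2_norm M g)\<^sup>2
      - 4 * (L2_norm M (\<lambda>x. (f x + g x) / 2))\<^sup>2"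
    using assms unfolding L2_norm_square by (simp add: L2_def)
  finally show ?thesis .
qed

section \<open>Fatou's lemma, completeness and dominated convergence in L2\<close>

lemma L2_norm_Fatou:
  assumes fs: "\<And>n. fs n \<in> L2 M" and f [measurable]: "f \<in> borel_measurable M"
    and lim: "AE x in M. (\<lambda>n. fs n x) \<longlonglongrightarrow> f x"
    and B: "\<And>n. n \<ge> N \<Longrightarrow> L2_norm M (fs n) \<le> B"
  shows "f \<in> L2 M" and "L2_norm M f \<le> B"
proof -
  note [measurable] = fs[THEN L2_measurable]
  have B0: "0 \<le> B" using B[of N] L2_norm_nonneg order_trans by blast
  have nn: "(\<integral>\<^sup>+x. ennreal ((g x)\<^sup>2) \<partial>M) = ennreal ((L2_norm M g)\<^sup>2)" if "g \<in> L2 M" for g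
    unfolding L2_norm_square using that by (intro nn_integral_eq_integral) (auto simp: L2_def)
  have "(\<integral>\<^sup>+x. ennreal ((f x)\<^sup>2) \<partial>M) = (\<integral>\<^sup>+x. liminf (\<lambda>n. ennreal ((fs n x)\<^sup>2)) \<partial>M)"
  proof (rule nn_integral_cong_AE)
    show "AE x in M. ennreal ((f x)\<^sup>2) = liminf (\<lambda>n. ennreal ((fs n x)\<^sup>2))"
      using lim
    proof eventually_elim
      case (elim x)
      then have "(\<lambda>n. ennreal ((fs n x)\<^sup>2)) \<longlonglongrightarrow> ennreal ((f x)\<^sup>2)"
        by (intro tendsto_ennrealI tendsto_power)
      then show ?case by (metis lim_imp_Liminf trivial_limit_sequentially)
    qed
  qed
  also have "\<dots> \<le> liminf (\<lambda>n. \<integral>\<^sup>+x. ennreal ((fs n x)\<^sup>2) \<partial>M)"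
    by (rule nn_integral_liminf) measurable
  also have "\<dots> \<le> limsup (\<lambda>n. \<integral>\<^sup>+x. ennreal ((fs n x)\<^sup>2) \<partial>M)"
    by (rule Liminf_le_Limsup) simp
  also have "\<dots> \<le> ennreal (B\<^sup>2)"
  proof (rule Limsup_bounded)
    show "\<forall>\<^sub>F n in sequentially. (\<integral>\<^sup>+x. ennreal ((fs n x)\<^sup>2) \<partial>M) \<le> ennreal (B\<^sup>2)"
      using eventually_ge_at_top[of N]
      by eventually_elim (simp add: nn[OF fs] B power_mono ennreal_leI)
  qed
  finally have le: "(\<integral>\<^sup>+x. ennreal ((f x)\<^sup>2) \<partial>M) \<le> ennreal (B\<^sup>2)" .
  then have "integrable M (\<lambda>x. (f x)\<^sup>2)"
    by (intro integrableI_bounded) (auto simp: le_less_trans ennreal_less_top)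
  then show L: "f \<in> L2 M" by (simp add: L2_def)
  have "(L2_norm M f)\<^sup>2 \<le> B\<^sup>2" using le by (simp add: nn[OF L] ennreal_le_iff)
  then show "L2_norm M f \<le> B" using B0 by (rule power2_le_imp_le)
qed

text \<open>With the weights \<open>4 ^ i\<close> the integrals of the squares are still summable,
  being at most \<open>K^2 * (1/4) ^ i\<close>. Hence almost everywhere the terms are bounded by a
  multiple of \<open>(1/2) ^ i\<close> and the series converges absolutely; Fatou on the tails turns
  this into norm convergence.\<close>

lemma L2_geometric_series:
  assumes fs: "\<And>i. fs i \<in> L2 M" and bound: "\<And>i. L2_norm M (fs i) \<le> K * (1/4) ^ i"
  obtains s where "s \<in> L2 M" "(\<lambda>n. L2_norm M (\<lambda>x. s x - (\<Sum>i<n. fs i x))) \<longlonglongrightarrow> 0"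
    "L2_norm M s \<le> 2 * K"
proof -
  note [measurable] = fs[THEN L2_measurable]
  have K: "0 \<le> K" using bound[of 0] order_trans[OF L2_norm_nonneg] by fastforce
  define S where "S n = (\<lambda>x. \<Sum>i<n. fs i x)" for n
  \<comment> \<open>Where the series diverges, \<open>suminf\<close> is a default value. This
    happens only on a null set and does not affect measurability.\<close>
  define s where "s x = (\<Sum>i. fs i x)" for x
  have S: "S n \<in> L2 M" for n unfolding S_def by (intro L2_sum fs)
  have [measurable]: "s \<in> borel_measurable M" unfolding s_def by measurable
  have "(\<integral>\<^sup>+x. (\<Sum>i. ennreal (4 ^ i * (fs i x)\<^sup>2)) \<partial>M)
      = (\<Sum>i. \<integral>\<^sup>+x. ennreal (4 ^ i * (fs i x)\<^sup>2) \<partial>M)"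
    by (rule nn_integral_suminf) measurable
  also have "\<dots> \<le> (\<Sum>i. ennreal (K\<^sup>2 * (1/4) ^ i))"
  proof (intro suminf_le)
    fix i
    have "integrable M (\<lambda>x. 4 ^ i * (fs i x)\<^sup>2)" using fs by (auto simp: L2_def)
    then have "(\<integral>\<^sup>+x. ennreal (4 ^ i * (fs i x)\<^sup>2) \<partial>M) = ennreal (\<integral>x. 4 ^ i * (fs i x)\<^sup>2 \<partial>M)"
      by (intro nn_integral_eq_integral) auto
    also have "(\<integral>x. 4 ^ i * (fs i x)\<^sup>2 \<partial>M) = 4 ^ i * (L2_norm M (fs i))\<^sup>2"
      by (simp add: L2_norm_square)
    also have "\<dots> \<le> 4 ^ i * (K * (1/4) ^ i)\<^sup>2"
      using bound by (intro mult_left_mono power_mono) auto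
    also have "\<dots> = K\<^sup>2 * (1/4) ^ i"
      by (simp add: power2_eq_square power_divide field_simps)
    finally show "(\<integral>\<^sup>+x. ennreal (4 ^ i * (fs i x)\<^sup>2) \<partial>M) \<le> ennreal (K\<^sup>2 * (1/4) ^ i)"
      by (simp add: ennreal_leI)
  qed auto
  also have "\<dots> = ennreal (\<Sum>i. K\<^sup>2 * (1/4) ^ i)"
    by (rule suminf_ennreal2) (auto intro: summable_mult summable_geometric)
  finally have "(\<integral>\<^sup>+x. (\<Sum>i. ennreal (4 ^ i * (fs i x)\<^sup>2)) \<partial>M) \<noteq> \<infinity>"
    by (auto simp: top_unique)
  then have "AE x in M. (\<Sum>i. ennreal (4 ^ i * (fs i x)\<^sup>2)) \<noteq> \<infinity>"
    by (intro nn_integral_noteq_infinite) measurable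
  then have lim: "AE x in M. (\<lambda>n. S n x) \<longlonglongrightarrow> s x"
  proof eventually_elim
    case (elim x)
    let ?a = "\<lambda>i. 4 ^ i * (fs i x)\<^sup>2"
    have sa: "summable ?a" using elim by (intro summable_suminf_not_top) (auto simp: less_top)
    have "summable (\<lambda>i. fs i x)"
    proof (rule summable_comparison_test)
      show "summable (\<lambda>i. sqrt (suminf ?a) * (1/2) ^ i)"
        by (intro summable_mult summable_geometric) simp
      have "\<bar>fs i x\<bar> \<le> sqrt (suminf ?a) * (1/2) ^ i" for i
      proof -
        have "?a i \<le> suminf ?a" using sum_le_suminf[OF sa, of "{i}"] by simp
        then have "sqrt (?a i) \<le> sqrt (suminf ?a)" by simp
        moreover have "sqrt (?a i) = 2 ^ i * \<bar>fs i x\<bar>"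
        proof -
          have "?a i = (2 ^ i * \<bar>fs i x\<bar>)\<^sup>2"
            by (simp add: power_mult_distrib power_mult[symmetric] mult.commute[of i] power_mult)
          then show ?thesis by (simp add: real_sqrt_mult)
        qed
        ultimately show ?thesis by (simp add: power_divide field_simps)
      qed
      then show "\<exists>N. \<forall>n\<ge>N. norm (fs n x) \<le> sqrt (suminf ?a) * (1/2) ^ n" by auto
    qed
    then show ?case unfolding S_def s_def by (rule summable_LIMSEQ)
  qed
  \<comment> \<open>The sharp factor 4/3 is rounded up to 2; this is the 2 in the final
    bound.\<close>
  have geo: "(\<Sum>i\<in>{n..<m}. K * (1/4) ^ i) \<le> 2 * K * (1/4) ^ n" for n m
  proof (cases "n \<le> m")
    case True
    have "(\<Sum>i\<in>{n..<m}. K * (1/4) ^ i) = K * (\<Sum>i\<in>{n..<m}. (1/4) ^ i)"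
      by (simp add: sum_distrib_left)
    also have "(\<Sum>i\<in>{n..<m}. (1/4::real) ^ i) = 4/3 * ((1/4) ^ n - (1/4) ^ m)"
      using True by (induction m rule: dec_induct) (auto simp: algebra_simps)
    also have "\<dots> \<le> 2 * (1/4) ^ n"
    proof -
      have "0 \<le> (1/4::real) ^ n" "0 \<le> (1/4::real) ^ m" by simp_all
      then show ?thesis by (simp only: algebra_simps)
    qed
    finally show ?thesis using K by (simp add: mult_left_mono)
  qed (use K in auto)
  have tail: "L2_norm M (\<lambda>x. S m x - S n x) \<le> 2 * K * (1/4) ^ n" if "n \<le> m" for m n
  proof -
    have "(\<lambda>x. S m x - S n x) = (\<lambda>x. \<Sum>i\<in>{n..<m}. fs i x)"
      using that unfolding S_def by (auto simp: fun_eq_iff sum_diff_nat_ivl lessThan_atLeast0)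
    then have "L2_norm M (\<lambda>x. S m x - S n x) \<le> (\<Sum>i\<in>{n..<m}. L2_norm M (fs i))"
      using L2_norm_sum[of "{n..<m}" fs M] fs by simp
    also have "\<dots> \<le> (\<Sum>i\<in>{n..<m}. K * (1/4) ^ i)" by (intro sum_mono bound)
    also have "\<dots> \<le> 2 * K * (1/4) ^ n" by (rule geo)
    finally show ?thesis .
  qed
  have diff: "(\<lambda>x. s x - S n x) \<in> L2 M \<and> L2_norm M (\<lambda>x. s x - S n x) \<le> 2 * K * (1/4) ^ n" for n
  proof -
    have *: "AE x in M. (\<lambda>m. S m x - S n x) \<longlonglongrightarrow> s x - S n x"
      using lim by eventually_elim (intro tendsto_intros)
    have [measurable]: "(\<lambda>x. s x - S n x) \<in> borel_measurable M"
      using L2_measurable[OF S] by (intro borel_measurable_diff) auto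
    note Fatou = L2_norm_Fatou[OF L2_diff[OF S S] _ *, of n "2 * K * (1/4) ^ n"]
    show ?thesis by (intro conjI Fatou tail) auto
  qed
  have "(\<lambda>n. L2_norm M (\<lambda>x. s x - S n x)) \<longlonglongrightarrow> 0"
  proof (rule tendsto_sandwich[OF _ _ tendsto_const])
    show "(\<lambda>n. 2 * K * (1/4) ^ n) \<longlonglongrightarrow> 0"
      by (intro tendsto_mult_right_zero LIMSEQ_realpow_zero) auto
  qed (use diff in auto)
  \<comment> \<open>The empty partial sum at index 0 yields both membership and the norm bound for
    \<open>s\<close>.\<close>
  with diff[of 0] show thesis
    by (intro that[of s]) (auto simp: S_def)
qed


lemma L2_norm_dominated_convergence:
  assumes fs: "\<And>n. fs n \<in> L2 M" and f: "f \<in> L2 M" and g: "g \<in> L2 M"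
    and lim: "AE x in M. (\<lambda>n. fs n x) \<longlonglongrightarrow> f x"
    and dom: "\<And>n x. \<bar>fs n x\<bar> \<le> g x" "\<And>x. \<bar>f x\<bar> \<le> g x"
  shows "(\<lambda>n. L2_norm M (\<lambda>x. fs n x - f x)) \<longlonglongrightarrow> 0"
proof -
  note [measurable] = fs[THEN L2_measurable] f[THEN L2_measurable] g[THEN L2_measurable]
  have "(\<lambda>n. \<integral>x. (fs n x - f x)\<^sup>2 \<partial>M) \<longlonglongrightarrow> (\<integral>x. 0 \<partial>M)"
  proof (rule integral_dominated_convergence)
    show "integrable M (\<lambda>x. (2 * g x)\<^sup>2)"
      using g by (intro L2_square_integrable L2_scale)
    show "AE x in M. (\<lambda>n. (fs n x - f x)\<^sup>2) \<longlonglongrightarrow> 0"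
      using lim
    proof eventually_elim
      case (elim x)
      then have "(\<lambda>n. (fs n x - f x)\<^sup>2) \<longlonglongrightarrow> (f x - f x)\<^sup>2" by (intro tendsto_intros)
      then show ?case by simp
    qed
    have "\<bar>fs n x - f x\<bar> \<le> \<bar>2 * g x\<bar>" for n x using dom(1)[of n x] dom(2)[of x] by linarith
    then show "AE x in M. norm ((fs n x - f x)\<^sup>2) \<le> (2 * g x)\<^sup>2" for n
      by (auto simp: abs_le_square_iff)
  qed auto
  then have "(\<lambda>n. sqrt (\<integral>x. (fs n x - f x)\<^sup>2 \<partial>M)) \<longlonglongrightarrow> sqrt 0"
    by (intro tendsto_real_sqrt) simp
  then show ?thesis by (simp add: L2_norm_def)
qed

section \<open>Reduction of lower semicontinuity to sublevel sets and almost everywhere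
  limits\<close>

lemma ext_L0_le_liminf:
  assumes conv: "loc_meas_conv M fs f"
    and closed: "\<And>r c. strict_mono r \<Longrightarrow> c < \<infinity> \<Longrightarrow> (\<And>n. fs (r n) \<in> L2 M) \<Longrightarrow>
      (\<And>n. E (fs (r n)) \<le> c) \<Longrightarrow> AE x in M. (\<lambda>n. fs (r n) x) \<longlonglongrightarrow> f x \<Longrightarrow>
      f \<in> L2 M \<and> E f \<le> c"
  shows "ext_L0 M E f \<le> liminf (\<lambda>n. ext_L0 M E (fs n))"
proof (rule ccontr)
  assume "\<not> ?thesis"
  \<comment> \<open>A level \<open>c\<close> strictly between the two sides is undercut infinitely
    often. This selects a subsequence \<open>r\<close> inside the sublevel set, and local
    convergence in measure refines it by \<open>s\<close> to one converging almost
    everywhere.\<close>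
  then have "liminf (\<lambda>n. ext_L0 M E (fs n)) < ext_L0 M E f" by simp
  then obtain c where c: "liminf (\<lambda>n. ext_L0 M E (fs n)) < c" "c < ext_L0 M E f"
    using dense[of "liminf (\<lambda>n. ext_L0 M E (fs n))"] by metis
  have "\<exists>\<^sub>F n in sequentially. ext_L0 M E (fs n) < c"
  proof (rule ccontr)
    assume "\<not> ?thesis"
    then have "\<forall>\<^sub>F n in sequentially. c \<le> ext_L0 M E (fs n)"
      by (simp add: not_frequently not_less)
    then have "c \<le> liminf (\<lambda>n. ext_L0 M E (fs n))" by (rule Liminf_bounded)
    with c(1) show False by simp
  qed
  then have inf: "infinite {n. ext_L0 M E (fs n) < c}"
    unfolding cofinite_eq_sequentially[symmetric] frequently_cofinite .
  obtain r :: "nat \<Rightarrow> nat" where r: "strict_mono r" "\<And>n. ext_L0 M E (fs (r n)) < c"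
    using infinite_enumerate[OF inf] by auto
  obtain s :: "nat \<Rightarrow> nat" where s: "strict_mono s"
    "AE x in M. (\<lambda>n. fs (r (s n)) x) \<longlonglongrightarrow> f x"
    using conv r(1) unfolding loc_meas_conv_def by blast
  have mem: "fs (r n) \<in> L2 M" "E (fs (r n)) \<le> c" for n
    using r(2)[of n] by (auto simp: ext_L0_def not_top_less split: if_splits)
  have "c < \<infinity>" using c(2) by (rule less_le_trans) simp
  then have "f \<in> L2 M \<and> E f \<le> c"
    using closed[of "r \<circ> s" c] mem s strict_mono_o[OF r(1) s(1)] by simp
  then show False using c(2) by (simp add: ext_L0_def flip: not_le)
qed

text \<open>A lower semicontinuous \<open>F\<close> is itself a competitor in the supremum and
  dominates all the others.\<close>

lemma relaxation_L0_eq: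
  assumes "lsc_L0 M F" "f \<in> borel_measurable M"
  shows "relaxation_L0 M F f = F f"
  unfolding relaxation_L0_def
  by (rule antisym) (use assms in \<open>auto intro!: SUP_least SUP_upper2[of F]\<close>)

section \<open>Symmetric convex functionals\<close>

locale symmetric_convex_functional =
  fixes M :: "'a measure" and E :: "('a \<Rightarrow> real) \<Rightarrow> ennreal"
  assumes lsc: "lsc_L2 M E"
    and convex: "convex_L2 M E"
    and symmetric: "f \<in> L2 M \<Longrightarrow> E (\<lambda>x. - f x) = E f"
    and zero: "E (\<lambda>x. 0) = 0"
begin

lemma E_convex_le:
  assumes "f \<in> L2 M" "g \<in> L2 M" "0 \<le> t" "t \<le> 1" "E f \<le> c" "E g \<le> c"
  shows "E (\<lambda>x. t * f x + (1 - t) * g x) \<le> c"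
proof -
  have "E (\<lambda>x. t * f x + (1 - t) * g x) \<le> ennreal t * E f + ennreal (1 - t) * E g"
    using convex assms unfolding convex_L2_def by blast
  also have "\<dots> \<le> ennreal t * c + ennreal (1 - t) * c"
    using assms by (intro add_mono mult_left_mono) auto
  also have "\<dots> = (ennreal t + ennreal (1 - t)) * c" by (simp add: distrib_right)
  also have "\<dots> = c" using assms by (simp flip: ennreal_plus)
  finally show ?thesis .
qed

lemma E_scale_le:
  assumes "f \<in> L2 M" "0 \<le> t" "t \<le> 1"
  shows "E (\<lambda>x. t * f x) \<le> ennreal t * E f"
proof -
  have "E (\<lambda>x. t * f x + (1 - t) * 0) \<le> ennreal t * E f + ennreal (1 - t) * E (\<lambda>x. 0)"
    by (rule convex[unfolded convex_L2_def, rule_format]) (use assms L2_zero in auto)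
  then show ?thesis by (simp add: zero)
qed

lemma E_le_of_L2_limit:
  assumes "\<And>n. fs n \<in> L2 M" "f \<in> L2 M" "(\<lambda>n. L2_norm M (\<lambda>x. fs n x - f x)) \<longlonglongrightarrow> 0"
    and "\<forall>\<^sub>F n in sequentially. E (fs n) \<le> c"
  shows "E f \<le> c"
proof -
  have "E f \<le> liminf (\<lambda>n. E (fs n))" using lsc assms unfolding lsc_L2_def by blast
  also have "\<dots> \<le> limsup (\<lambda>n. E (fs n))" by (rule Liminf_le_Limsup) simp
  also have "\<dots> \<le> c" using assms(4) by (rule Limsup_bounded)
  finally show ?thesis .
qed

text \<open>A substitute for weak compactness and Mazur's lemma: almost norm-minimal elements of a
  decreasing sequence of convex sets containing the tails form a Cauchy sequence by the
  parallelogram law, and the pointwise convergence identifies the limit.\<close>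

lemma E_le_of_AE_limit_bounded:
  assumes fs: "\<And>n. fs n \<in> L2 M" and f [measurable]: "f \<in> borel_measurable M"
    and lim: "AE x in M. (\<lambda>n. fs n x) \<longlonglongrightarrow> f x"
    and R: "\<And>n. L2_norm M (fs n) \<le> R" and c: "\<And>n. E (fs n) \<le> c"
  shows "f \<in> L2 M" and "E f \<le> c"
proof -
  have fL: "f \<in> L2 M" and fR: "L2_norm M f \<le> R"
    using L2_norm_Fatou[OF fs f lim R] by blast+
  show "f \<in> L2 M" by fact
  \<comment> \<open>\<open>K n\<close> replaces the convex hull of the tail from \<open>n\<close>
    on. Its last clause keeps \<open>u\<close> pointwise no farther from \<open>f\<close> than the
    worst tail member; it survives midpoints and is vacuous at points where the tail is
    unbounded.\<close>
  define K where "K n = {u \<in> L2 M. E u \<le> c \<and>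
    (\<forall>x B. (\<forall>k\<ge>n. \<bar>fs k x - f x\<bar> \<le> B) \<longrightarrow> \<bar>u x - f x\<bar> \<le> B)}" for n
  let ?d = "\<lambda>u. (L2_norm M (\<lambda>x. u x - f x))\<^sup>2"
  have fsK: "fs n \<in> K n" for n using fs c by (auto simp: K_def)
  have Kmono: "K m \<subseteq> K n" if "n \<le> m" for m n using that by (auto simp: K_def)
  have Kmid: "(\<lambda>x. (u x + v x) / 2) \<in> K n" if "u \<in> K n" "v \<in> K n" for u v n
  proof -
    have "E (\<lambda>x. 1/2 * u x + (1 - 1/2) * v x) \<le> c"
      using that by (intro E_convex_le) (auto simp: K_def)
    moreover have "(\<lambda>x. 1/2 * u x + (1 - 1/2) * v x) = (\<lambda>x. (u x + v x) / 2)"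
      by (auto simp: field_simps)
    moreover have "\<bar>(u x + v x) / 2 - f x\<bar> \<le> B" if B: "\<forall>k\<ge>n. \<bar>fs k x - f x\<bar> \<le> B" for x B
    proof -
      have "\<bar>u x - f x\<bar> \<le> B" "\<bar>v x - f x\<bar> \<le> B"
        using B \<open>u \<in> K n\<close> \<open>v \<in> K n\<close> by (auto simp: K_def)
      then show ?thesis by (simp add: abs_le_iff field_simps)
    qed
    ultimately show ?thesis using that by (auto simp: K_def intro!: L2_divide L2_add)
  qed
  \<comment> \<open>The squared distance from \<open>f\<close> to \<open>K n\<close>: increasing as
    the sets shrink, and bounded because the sequence is.\<close>
  define a where "a n = Inf (?d ` K n)" for n
  have bdd: "bdd_below (?d ` K n)" for n by (intro bdd_belowI[of _ 0]) auto
  have a_le: "a n \<le> ?d u" if "u \<in> K n" for n u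
    unfolding a_def using that bdd by (intro cInf_lower) auto
  have "a n \<le> a m" if "n \<le> m" for n m
    unfolding a_def using fsK[of m] Kmono[OF that] by (intro cInf_superset_mono bdd) auto
  then have inc: "incseq a" by (rule incseq_def[THEN iffD2, rule_format])
  have "a n \<le> (2 * R)\<^sup>2" for n
  proof -
    have "a n \<le> ?d (fs n)" by (rule a_le[OF fsK])
    also have "\<dots> \<le> (2 * R)\<^sup>2"
    proof (rule power_mono)
      show "L2_norm M (\<lambda>x. fs n x - f x) \<le> 2 * R"
        using L2_norm_triangle_diff[OF fs[of n] fL] R[of n] fR by linarith
    qed simp
    finally show ?thesis .
  qed
  then obtain A where A: "a \<longlonglongrightarrow> A" "\<And>n. a n \<le> A"
    using incseq_convergent[OF inc] by metis
  have "\<exists>u\<in>K n. ?d u < a n + 1 / Suc n" for n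
  proof -
    have "Inf (?d ` K n) < a n + 1 / Suc n" by (simp add: a_def)
    then show ?thesis using fsK bdd by (subst (asm) cInf_less_iff) auto
  qed
  then obtain u where u: "\<And>n. u n \<in> K n" "\<And>n. ?d (u n) < a n + 1 / Suc n" by metis
  have uL: "u n \<in> L2 M" and uE: "E (u n) \<le> c" for n using u by (auto simp: K_def)
  \<comment> \<open>For \<open>n \<le> m\<close> the midpoint of \<open>u n\<close> and
    \<open>u m\<close> lies in \<open>K n\<close>, so its squared distance to \<open>f\<close> is at
    least \<open>a n\<close>. The parallelogram law then leaves \<open>2 * (a m - a n)\<close> plus
    the slacks, which \<open>\<eta> n\<close> bounds generously.\<close>
  define \<eta> where "\<eta> n = 4 * (A - a n) + 4 / Suc n" for n
  have \<eta>0: "0 \<le> \<eta> n" for n using A(2)[of n] by (simp add: \<eta>_def)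
  have cauchy: "L2_norm M (\<lambda>x. u n x - u m x) \<le> sqrt (\<eta> n)" if "n \<le> m" for n m
  proof (rule real_le_rsqrt)
    have "(L2_norm M (\<lambda>x. u n x - u m x))\<^sup>2
        = (L2_norm M (\<lambda>x. (u n x - f x) - (u m x - f x)))\<^sup>2" by simp
    also have "\<dots> = 2 * ?d (u n) + 2 * ?d (u m)
        - 4 * (L2_norm M (\<lambda>x. ((u n x - f x) + (u m x - f x)) / 2))\<^sup>2"
      by (intro L2_norm_parallelogram L2_diff uL fL)
    also have "(\<lambda>x. ((u n x - f x) + (u m x - f x)) / 2) = (\<lambda>x. (u n x + u m x) / 2 - f x)"
      by (auto simp: field_simps)
    also have "2 * ?d (u n) + 2 * ?d (u m) - 4 * ?d (\<lambda>x. (u n x + u m x) / 2)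
        \<le> 2 * (a n + 1 / Suc n) + 2 * (a m + 1 / Suc m) - 4 * a n"
    proof -
      have "a n \<le> ?d (\<lambda>x. (u n x + u m x) / 2)"
        using Kmid u(1) Kmono[OF that] by (intro a_le) blast
      then show ?thesis using u(2)[of n] u(2)[of m] by simp
    qed
    also have "\<dots> \<le> \<eta> n"
    proof -
      have "1 / real (Suc m) \<le> 1 / Suc n" using that by (intro divide_left_mono) auto
      moreover have "4 / real (Suc n) = 4 * (1 / Suc n)" by simp
      ultimately show ?thesis unfolding \<eta>_def using A(2)[of m] A(2)[of n] by argo
    qed
    finally show "(L2_norm M (\<lambda>x. u n x - u m x))\<^sup>2 \<le> \<eta> n" .
  qed
  have ulim: "AE x in M. (\<lambda>n. u n x) \<longlonglongrightarrow> f x"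
    using lim
  proof eventually_elim
    case (elim x)
    show ?case
    proof (rule LIMSEQ_I)
      fix e :: real assume "e > 0"
      then obtain N where N: "\<And>k. k \<ge> N \<Longrightarrow> \<bar>fs k x - f x\<bar> < e / 2"
        using LIMSEQ_D[OF elim, of "e / 2"] by auto
      have "\<bar>u n x - f x\<bar> \<le> e / 2" if "n \<ge> N" for n
      proof -
        have "\<forall>k\<ge>n. \<bar>fs k x - f x\<bar> \<le> e / 2" using N that by (auto intro: less_imp_le)
        moreover have "(\<forall>k\<ge>n. \<bar>fs k x - f x\<bar> \<le> B) \<longrightarrow> \<bar>u n x - f x\<bar> \<le> B" for B
          using u(1)[of n] by (auto simp: K_def)
        ultimately show ?thesis by blast
      qed
      then show "\<exists>N. \<forall>n\<ge>N. norm (u n x - f x) < e"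
        using \<open>e > 0\<close> by (intro exI[of _ N]) fastforce
    qed
  qed
  \<comment> \<open>Fatou in \<open>m\<close> passes the Cauchy estimate to the limit; the estimate
    is only available from \<open>m = n\<close> on, hence the choice of \<open>N\<close>.\<close>
  have "L2_norm M (\<lambda>x. u n x - f x) \<le> sqrt (\<eta> n)" for n
  proof (rule L2_norm_Fatou(2)[where fs = "\<lambda>m x. u n x - u m x" and N = n])
    show "AE x in M. (\<lambda>m. u n x - u m x) \<longlonglongrightarrow> u n x - f x"
      using ulim by eventually_elim (intro tendsto_intros)
  qed (use uL fL cauchy in \<open>auto intro: L2_diff L2_measurable\<close>)
  moreover have "(\<lambda>n. sqrt (\<eta> n)) \<longlonglongrightarrow> sqrt (4 * (A - A) + 0)"
    unfolding \<eta>_def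
    by (intro tendsto_intros A LIMSEQ_Suc[OF lim_const_over_n])
  ultimately have "(\<lambda>n. L2_norm M (\<lambda>x. u n x - f x)) \<longlonglongrightarrow> 0"
    using Lim_null_comparison[of "\<lambda>n. L2_norm M (\<lambda>x. u n x - f x)" "\<lambda>n. sqrt (\<eta> n)"] by simp
  then show "E f \<le> c" using uE by (intro E_le_of_L2_limit[OF uL fL]) simp_all
qed

subsection \<open>The Luxemburg seminorm\<close>

text \<open>Convexity and \<open>E 0 = 0\<close> force at least linear decay below the scale
  \<open>l\<close>: \<open>E (t f) <= (t / l) * E (l f)\<close>.\<close>

lemma modular_spaceI:
  assumes "f \<in> L2 M" "l > 0" "E (\<lambda>x. l * f x) < \<infinity>"
  shows "f \<in> modular_space M E"
proof -
  obtain b where b: "E (\<lambda>x. l * f x) = ennreal b" "0 \<le> b"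
    using assms(3) by (cases "E (\<lambda>x. l * f x)") auto
  have "((\<lambda>t. E (\<lambda>x. t * f x)) \<longlongrightarrow> 0) (at_right 0)"
  proof (rule tendsto_sandwich[OF _ _ tendsto_const])
    have "((\<lambda>t. ennreal (t / l * b)) \<longlongrightarrow> ennreal (0 / l * b)) (at_right 0)"
      using assms(2) by (intro tendsto_ennrealI tendsto_intros) auto
    then show "((\<lambda>t. ennreal (t / l * b)) \<longlongrightarrow> 0) (at_right 0)" by simp
    show "\<forall>\<^sub>F t in at_right 0. E (\<lambda>x. t * f x) \<le> ennreal (t / l * b)"
      using eventually_at_right_real[OF assms(2)]
    proof eventually_elim
      case (elim t)
      have "E (\<lambda>x. (t / l) * (l * f x)) \<le> ennreal (t / l) * E (\<lambda>x. l * f x)"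
        using elim assms by (intro E_scale_le L2_scale) auto
      then show ?case using elim assms b by (simp flip: ennreal_mult)
    qed
  qed auto
  then show ?thesis using assms(1) by (simp add: modular_space_def)
qed

lemma modular_space_L2: "f \<in> modular_space M E \<Longrightarrow> f \<in> L2 M"
  by (simp add: modular_space_def)

lemma modular_space_finite: "f \<in> L2 M \<Longrightarrow> E f < \<infinity> \<Longrightarrow> f \<in> modular_space M E"
  by (rule modular_spaceI[of f 1]) auto

lemma E_scale_mono:
  assumes "f \<in> L2 M" "0 \<le> s" "s \<le> t"
  shows "E (\<lambda>x. s * f x) \<le> E (\<lambda>x. t * f x)"
proof (cases "t = 0")
  case False
  then have "E (\<lambda>x. s / t * (t * f x)) \<le> ennreal (s / t) * E (\<lambda>x. t * f x)"
    using assms by (intro E_scale_le L2_scale) auto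
  also have "\<dots> \<le> 1 * E (\<lambda>x. t * f x)"
    using assms False by (intro mult_right_mono) (auto simp: ennreal_le_1)
  finally show ?thesis using False by simp
qed (use assms in auto)

text \<open>Ensures that the infimum defining the Luxemburg seminorm runs over a nonempty set, so
  that \<open>Inf\<close> is not a default value.\<close>

lemma modular_spaceD:
  assumes "f \<in> modular_space M E"
  obtains l where "l > 0" "E (\<lambda>x. f x / l) \<le> 1"
proof -
  have "\<forall>\<^sub>F t in at_right 0. E (\<lambda>x. t * f x) < 1"
    using assms by (intro order_tendstoD(2)) (auto simp: modular_space_def)
  then have "\<forall>\<^sub>F t in at_right (0::real). E (\<lambda>x. t * f x) < 1 \<and> 0 < t"
    using eventually_at_right_less by (rule eventually_conj)
  then obtain t where "E (\<lambda>x. t * f x) < 1" "0 < t"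
    using eventually_happens'[OF trivial_limit_at_right_real] by blast
  then show thesis by (intro that[of "1 / t"]) (auto simp: mult.commute)
qed

lemma luxemburg_le: "l > 0 \<Longrightarrow> E (\<lambda>x. f x / l) \<le> 1 \<Longrightarrow> luxemburg E f \<le> l"
  unfolding luxemburg_def by (intro cInf_lower) (auto intro!: bdd_belowI[of _ 0])

lemma luxemburg_nonneg: "f \<in> modular_space M E \<Longrightarrow> 0 \<le> luxemburg E f"
  unfolding luxemburg_def by (erule modular_spaceD, intro cInf_greatest) auto

text \<open>Since \<open>E\<close> is monotone under scaling, the admissible \<open>l\<close> form
  an upward closed set, which therefore contains everything strictly above its infimum.\<close>

lemma luxemburg_lessD:
  assumes "f \<in> modular_space M E" "luxemburg E f < l"
  shows "l > 0" "E (\<lambda>x. f x / l) \<le> 1"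
proof -
  show "l > 0" using luxemburg_nonneg[OF assms(1)] assms(2) by simp
  have "{l. l > 0 \<and> E (\<lambda>x. f x / l) \<le> 1} \<noteq> {}"
    using modular_spaceD[OF assms(1)] by blast
  from cInf_lessD[OF this assms(2)[unfolded luxemburg_def]]
  obtain k where k: "k > 0" "E (\<lambda>x. f x / k) \<le> 1" "k < l" by blast
  have "E (\<lambda>x. 1 / l * f x) \<le> E (\<lambda>x. 1 / k * f x)"
    using k modular_space_L2[OF assms(1)] by (intro E_scale_mono) (auto intro!: divide_left_mono)
  then show "E (\<lambda>x. f x / l) \<le> 1" using k by simp
qed

lemma luxemburg_zero: "luxemburg E (\<lambda>x. 0) = 0"
proof (rule antisym)
  show "luxemburg E (\<lambda>x. 0) \<le> 0"
    using luxemburg_le[of _ "\<lambda>x. 0"] by (rule_tac field_le_epsilon) (simp add: zero)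
  show "0 \<le> luxemburg E (\<lambda>x. 0)"
    by (intro luxemburg_nonneg modular_space_finite) (simp_all add: L2_zero zero)
qed

lemma luxemburg_scale_le:
  assumes f: "f \<in> modular_space M E" and c: "c > 0"
  shows "(\<lambda>x. c * f x) \<in> modular_space M E" "luxemburg E (\<lambda>x. c * f x) \<le> c * luxemburg E f"
proof -
  obtain l where l: "l > 0" "E (\<lambda>x. f x / l) \<le> 1" using modular_spaceD[OF f] .
  have "E (\<lambda>x. 1 / (c * l) * (c * f x)) < \<infinity>"
    using l c by (rule_tac le_less_trans[of _ 1]) auto
  then show "(\<lambda>x. c * f x) \<in> modular_space M E"
    using l c modular_space_L2[OF f] by (intro modular_spaceI[of _ "1 / (c * l)"] L2_scale) auto
  have "luxemburg E (\<lambda>x. c * f x) / c \<le> luxemburg E f"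
  proof (rule dense_ge)
    fix l assume "luxemburg E f < l"
    note l = luxemburg_lessD[OF f this]
    then have "luxemburg E (\<lambda>x. c * f x) \<le> c * l"
      using c by (intro luxemburg_le) auto
    then show "luxemburg E (\<lambda>x. c * f x) / c \<le> l" using c by (simp add: field_simps)
  qed
  then show "luxemburg E (\<lambda>x. c * f x) \<le> c * luxemburg E f" using c by (simp add: field_simps)
qed

lemma luxemburg_minus:
  assumes "f \<in> modular_space M E"
  shows "(\<lambda>x. - f x) \<in> modular_space M E" "luxemburg E (\<lambda>x. - f x) = luxemburg E f"
proof -
  have *: "E (\<lambda>x. - (c * f x)) = E (\<lambda>x. c * f x)" for c
    using assms by (intro symmetric L2_scale modular_space_L2)
  show "(\<lambda>x. - f x) \<in> modular_space M E"
    using assms by (auto simp: modular_space_def * intro: L2_minus)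
  have "E (\<lambda>x. - (f x / l)) = E (\<lambda>x. f x / l)" for l
    using *[of "1 / l"] by simp
  then show "luxemburg E (\<lambda>x. - f x) = luxemburg E f"
    by (simp add: luxemburg_def)
qed

text \<open>\<open>(f + g) / (k + l)\<close> is the convex combination of \<open>f / k\<close> and
  \<open>g / l\<close> with weights \<open>k / (k + l)\<close> and
  \<open>l / (k + l)\<close>.\<close>

lemma luxemburg_triangle:
  assumes f: "f \<in> modular_space M E" and g: "g \<in> modular_space M E"
  shows "(\<lambda>x. f x + g x) \<in> modular_space M E"
    "luxemburg E (\<lambda>x. f x + g x) \<le> luxemburg E f + luxemburg E g"
proof -
  note L = f[THEN modular_space_L2] g[THEN modular_space_L2]
  have sum: "E (\<lambda>x. (f x + g x) / (k + l)) \<le> 1"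
    if kl: "k > 0" "l > 0" "E (\<lambda>x. f x / k) \<le> 1" "E (\<lambda>x. g x / l) \<le> 1" for k l
  proof -
    have "E (\<lambda>x. k / (k + l) * (f x / k) + (1 - k / (k + l)) * (g x / l)) \<le> 1"
      using kl L by (intro E_convex_le L2_divide) auto
    also have "(\<lambda>x. k / (k + l) * (f x / k) + (1 - k / (k + l)) * (g x / l))
        = (\<lambda>x. (f x + g x) / (k + l))"
    proof
      fix x
      have "1 - k / (k + l) = l / (k + l)" using kl by (simp add: field_simps)
      then show "k / (k + l) * (f x / k) + (1 - k / (k + l)) * (g x / l) = (f x + g x) / (k + l)"
        using kl by (simp add: add_divide_distrib)
    qed
    finally show ?thesis .
  qed
  obtain k where k: "k > 0" "E (\<lambda>x. f x / k) \<le> 1" using modular_spaceD[OF f] .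
  obtain l where l: "l > 0" "E (\<lambda>x. g x / l) \<le> 1" using modular_spaceD[OF g] .
  have "E (\<lambda>x. (f x + g x) / (k + l)) < \<infinity>" 
    using sum[OF k(1) l(1) k(2) l(2)] by (rule le_less_trans) simp
  then show "(\<lambda>x. f x + g x) \<in> modular_space M E"
    using k l L by (intro modular_spaceI[of _ "1 / (k + l)"] L2_add) auto
  show "luxemburg E (\<lambda>x. f x + g x) \<le> luxemburg E f + luxemburg E g"
  proof (rule field_le_epsilon)
    fix e :: real assume "e > 0"
    then have lt: "luxemburg E f < luxemburg E f + e / 2" "luxemburg E g < luxemburg E g + e / 2"
      by auto
    note * = luxemburg_lessD[OF f lt(1)] luxemburg_lessD[OF g lt(2)]
    have "luxemburg E (\<lambda>x. f x + g x) \<le> (luxemburg E f + e / 2) + (luxemburg E g + e / 2)"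
      using * by (intro luxemburg_le sum) auto
    then show "luxemburg E (\<lambda>x. f x + g x) \<le> luxemburg E f + luxemburg E g + e" by simp
  qed
qed

lemma luxemburg_triangle_diff:
  assumes f: "f \<in> modular_space M E" and g: "g \<in> modular_space M E"
  shows "(\<lambda>x. f x - g x) \<in> modular_space M E"
    "luxemburg E (\<lambda>x. f x - g x) \<le> luxemburg E f + luxemburg E g"
  using luxemburg_triangle[OF f luxemburg_minus(1)[OF g]] luxemburg_minus[OF g] by simp_all

lemma luxemburg_diff_commute:
  assumes f: "f \<in> modular_space M E" and g: "g \<in> modular_space M E"
  shows "luxemburg E (\<lambda>x. f x - g x) = luxemburg E (\<lambda>x. g x - f x)"
  using luxemburg_minus(2)[OF luxemburg_triangle_diff(1)[OF g f]] by simp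

lemma luxemburg_dist_triangle:
  assumes "f \<in> modular_space M E" "g \<in> modular_space M E" "h \<in> modular_space M E"
  shows "luxemburg E (\<lambda>x. f x - h x)
    \<le> luxemburg E (\<lambda>x. f x - g x) + luxemburg E (\<lambda>x. g x - h x)"
  using luxemburg_triangle(2)[OF luxemburg_triangle_diff(1)[OF assms(1,2)]
      luxemburg_triangle_diff(1)[OF assms(2,3)]] by simp

subsection \<open>Continuity of the embedding of a complete modular space into L2\<close>

text \<open>Baire's argument for the covering of the modular space by L2 balls of integer radius:
  one of them is Luxemburg-dense in some Luxemburg ball. Otherwise nested balls, the one chosen at
  stage \<open>n\<close> avoiding the L2 ball of radius \<open>n\<close>, would shrink to a point of
  infinite L2 norm.\<close>

lemma modular_Baire:
  assumes "modular_banach M E"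
  obtains x r k where "x \<in> modular_space M E" "r > 0"
    "\<forall>y\<in>modular_space M E. luxemburg E (\<lambda>t. y t - x t) < r \<longrightarrow>
      (\<forall>e>0. \<exists>z\<in>modular_space M E. L2_norm M z \<le> real k \<and> luxemburg E (\<lambda>t. y t - z t) < e)"
proof (rule ccontr)
  note found = that
  let ?V = "modular_space M E" and ?q = "\<lambda>u v. luxemburg E (\<lambda>t. u t - v t)"
  assume "\<not> thesis"
  then have nowhere_dense: "\<exists>y\<in>?V. ?q y x < r \<and> (\<exists>e>0. \<forall>z\<in>?V. L2_norm M z \<le> real k \<longrightarrow> e \<le> ?q y z)"
    if "x \<in> ?V" "r > 0" for x r k
    using that found[of x r k]
    by (meson not_less)
  define P where "P xr \<longleftrightarrow> fst xr \<in> ?V \<and> snd xr > 0" for xr :: "('a \<Rightarrow> real) \<times> real"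
  \<comment> \<open>Pairs are a centre and a radius. Both halvings together nest the closed balls,
    and the strict inequality makes the new closed ball miss the L2 ball.\<close>
  define Q where "Q n xr ys \<longleftrightarrow> ?q (fst ys) (fst xr) < snd xr / 2 \<and> snd ys \<le> snd xr / 2 \<and>
      (\<forall>z\<in>?V. L2_norm M z \<le> real n \<longrightarrow> snd ys < ?q (fst ys) z)"
    for n :: nat and xr ys :: "('a \<Rightarrow> real) \<times> real"
  have "\<exists>f. \<forall>n. P (f n) \<and> Q n (f n) (f (Suc n))"
  proof (rule dependent_nat_choice)
    have "(\<lambda>x. 0) \<in> ?V" by (rule modular_space_finite) (simp_all add: L2_zero zero)
    then show "\<exists>xr. P xr" by (intro exI[of _ "(\<lambda>x. 0, 1)"]) (simp add: P_def)
  next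
    fix xr n assume "P xr"
    then obtain y e where y: "y \<in> ?V" "?q y (fst xr) < snd xr / 2" "e > 0"
      "\<And>z. z \<in> ?V \<Longrightarrow> L2_norm M z \<le> real n \<Longrightarrow> e \<le> ?q y z"
      using nowhere_dense[of "fst xr" "snd xr / 2" n] by (auto simp: P_def)
    let ?ys = "(y, min (snd xr / 2) (e / 2))"
    have "P ?ys" using y \<open>P xr\<close> by (simp add: P_def)
    moreover have "min (snd xr / 2) (e / 2) < ?q y z" if "z \<in> ?V" "L2_norm M z \<le> real n" for z
      using y(3) y(4)[OF that] by linarith
    then have "Q n xr ?ys" using y by (simp add: Q_def)
    ultimately show "\<exists>ys. P ys \<and> Q n xr ys" by blast
  qed
  then obtain w where w: "\<And>n. P (w n)" "\<And>n. Q n (w n) (w (Suc n))" by blast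
  define x where "x n = fst (w n)" for n
  define r where "r n = snd (w n)" for n
  have xV: "x n \<in> ?V" and r0: "r n > 0" for n using w(1)[of n] by (auto simp: P_def x_def r_def)
  have step: "?q (x (Suc n)) (x n) < r n / 2" "r (Suc n) \<le> r n / 2" for n
    using w(2)[of n] by (auto simp: Q_def x_def r_def)
  have far: "r (Suc n) < ?q (x (Suc n)) z" if "z \<in> ?V" "L2_norm M z \<le> real n" for n z
    using w(2)[of n] that by (auto simp: Q_def x_def r_def)
  \<comment> \<open>Telescoping: each move is below \<open>r m / 2\<close>, which is at most
    \<open>r m - r (Suc m)\<close>.\<close>
  have nested: "?q (x m) (x n) \<le> r n - r m" if "n \<le> m" for n m
    using that
  proof (induction m rule: dec_induct)
    case base
    show ?case by (simp add: luxemburg_zero)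
  next
    case (step m)
    have "?q (x (Suc m)) (x n) \<le> ?q (x (Suc m)) (x m) + ?q (x m) (x n)"
      by (intro luxemburg_dist_triangle xV)
    then show ?case using step.IH \<open>?q (x (Suc m)) (x m) < r m / 2\<close> \<open>r (Suc m) \<le> r m / 2\<close>
      by linarith
  qed
  have r_le: "r n \<le> r 0 * (1/2) ^ n" for n
  proof (induction n)
    case (Suc n)
    then show ?case using step(2)[of n] by simp
  qed simp
  have cauchy: "\<exists>N. \<forall>m\<ge>N. \<forall>n\<ge>N. ?q (x m) (x n) < e" if "e > 0" for e
  proof -
    have "(\<lambda>n. r 0 * (1/2) ^ n) \<longlonglongrightarrow> 0"
      by (intro tendsto_mult_right_zero LIMSEQ_realpow_zero) auto
    then have "\<forall>\<^sub>F n in sequentially. r 0 * (1/2) ^ n < e"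
      using that by (rule order_tendstoD(2))
    then obtain N where N: "r 0 * (1/2) ^ N < e"
      using eventually_happens'[OF sequentially_bot] by blast
    have "?q (x m) (x n) < e" if mn: "n \<ge> N" "m \<ge> n" for m n
    proof -
      have "r 0 * (1/2) ^ n \<le> r 0 * (1/2) ^ N"
        using mn r0[of 0] by (intro mult_left_mono power_decreasing) auto
      then show ?thesis using nested[OF mn(2)] r_le[of n] r0[of m] N by linarith
    qed
    then have "?q (x m) (x n) < e" if "n \<ge> N" "m \<ge> N" for m n
      using that luxemburg_diff_commute[OF xV[of m] xV[of n]] nat_le_linear[of n m] by metis
    then show ?thesis by blast
  qed
  obtain y where y: "y \<in> ?V" "(\<lambda>n. ?q (x n) y) \<longlonglongrightarrow> 0"
    using assms xV cauchy unfolding modular_banach_def by blast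
  obtain n where n: "L2_norm M y \<le> real n" using real_arch_simple by blast
  \<comment> \<open>The limit stays in every closed ball, so \<open>far\<close> is contradicted with
    \<open>y\<close> itself in the role of \<open>z\<close>.\<close>
  have "?q (x (Suc n)) y \<le> r (Suc n)"
  proof (rule LIMSEQ_le_const)
    show "(\<lambda>m. r (Suc n) + ?q (x m) y) \<longlonglongrightarrow> r (Suc n)"
      using tendsto_add[OF tendsto_const y(2)] by simp
    have "?q (x (Suc n)) y \<le> r (Suc n) + ?q (x m) y" if "m \<ge> Suc n" for m
    proof -
      have "?q (x (Suc n)) y \<le> ?q (x (Suc n)) (x m) + ?q (x m) y"
        using xV y by (intro luxemburg_dist_triangle)
      then show ?thesis
        using nested[OF that] luxemburg_diff_commute[OF xV[of m] xV[of "Suc n"]] r0[of m]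
        by linarith
    qed
    then show "\<exists>N. \<forall>m\<ge>N. ?q (x (Suc n)) y \<le> r (Suc n) + ?q (x m) y" by blast
  qed
  then show False using far[OF y(1) n] by simp
qed

text \<open>Zabreiko's form of the open mapping argument: the Baire ball is recentred at the origin,
  and every element of it is then the sum of a geometrically decreasing series converging in both
  norms; lower semicontinuity identifies the two limits.\<close>

lemma modular_embedding_bounded:
  assumes banach: "modular_banach M E"
  obtains r K where "r > 0"
    "\<forall>y\<in>modular_space M E. luxemburg E y < r \<longrightarrow> L2_norm M y \<le> K"
proof -
  let ?V = "modular_space M E"
  obtain x r k where x: "x \<in> ?V" and r: "r > 0" and
    dense: "\<forall>y\<in>?V. luxemburg E (\<lambda>t. y t - x t) < r \<longrightarrow>
      (\<forall>e>0. \<exists>z\<in>?V. L2_norm M z \<le> real k \<and> luxemburg E (\<lambda>t. y t - z t) < e)"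
    using modular_Baire[OF banach] .
  \<comment> \<open>Approximate \<open>x + y\<close> by \<open>z\<close> and \<open>x - y\<close> by
    \<open>v\<close>; in the half difference the centre \<open>x\<close> cancels.\<close>
  have dense0: "\<exists>z\<in>?V. L2_norm M z \<le> real k \<and> luxemburg E (\<lambda>t. y t - z t) < e"
    if y: "y \<in> ?V" "luxemburg E y < r" and e: "e > 0" for y e
  proof -
    obtain z where z: "z \<in> ?V" "L2_norm M z \<le> real k" "luxemburg E (\<lambda>t. (x t + y t) - z t) < e"
      using dense[rule_format, of "\<lambda>t. x t + y t" e] luxemburg_triangle(1)[OF x y(1)] y(2) e by auto
    obtain v where v: "v \<in> ?V" "L2_norm M v \<le> real k" "luxemburg E (\<lambda>t. (x t - y t) - v t) < e"
      using dense[rule_format, of "\<lambda>t. x t - y t" e] luxemburg_triangle_diff(1)[OF x y(1)]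
        luxemburg_minus(2)[OF y(1)] y(2) e by auto
    let ?w = "\<lambda>t. 1/2 * (z t - v t)"
    have wV: "?w \<in> ?V"
      by (intro luxemburg_scale_le luxemburg_triangle_diff z v) simp
    have "L2_norm M ?w = 1/2 * L2_norm M (\<lambda>t. z t - v t)"
      by (subst L2_norm_scale) simp
    also have "\<dots> \<le> real k"
      using L2_norm_triangle_diff[OF z(1)[THEN modular_space_L2] v(1)[THEN modular_space_L2]]
        z(2) v(2) by linarith
    finally have wk: "L2_norm M ?w \<le> real k" .
    let ?a = "\<lambda>t. (x t + y t) - z t" and ?b = "\<lambda>t. (x t - y t) - v t"
    have aV: "?a \<in> ?V" by (intro luxemburg_triangle_diff luxemburg_triangle x y z)
    have bV: "?b \<in> ?V" by (intro luxemburg_triangle_diff x y v)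
    have "luxemburg E (\<lambda>t. y t - ?w t) = luxemburg E (\<lambda>t. 1/2 * (?a t - ?b t))"
      by (rule arg_cong[where f = "luxemburg E"]) (auto simp: field_simps)
    also have "\<dots> \<le> 1/2 * luxemburg E (\<lambda>t. ?a t - ?b t)"
      by (intro luxemburg_scale_le luxemburg_triangle_diff aV bV) simp
    also have "\<dots> < e"
      using luxemburg_triangle_diff(2)[OF aV bV] z(3) v(3) by linarith
    finally show ?thesis using wV wk by blast
  qed
  \<comment> \<open>Rescaling by \<open>s\<close>: subtracting \<open>s\<close> times an
    approximation of \<open>y / s\<close> leaves a remainder four times smaller in the Luxemburg
    seminorm, at an L2 cost of at most \<open>k * s\<close>.\<close>
  have approx: "\<exists>y'\<in>?V. luxemburg E y' < r * s / 4 \<and> L2_norm M (\<lambda>t. y t - y' t) \<le> real k * s"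
    if y: "y \<in> ?V" "luxemburg E y < r * s" and s: "s > 0" for y s
  proof -
    let ?y = "\<lambda>t. 1 / s * y t"
    have yV: "?y \<in> ?V" using s by (intro luxemburg_scale_le y) simp
    have "luxemburg E ?y \<le> 1 / s * luxemburg E y" using s by (intro luxemburg_scale_le y) simp
    also have "\<dots> < r" using y(2) s by (simp add: field_simps)
    finally obtain z where z: "z \<in> ?V" "L2_norm M z \<le> real k"
      "luxemburg E (\<lambda>t. ?y t - z t) < r / 4"
      using dense0[OF yV, of "r / 4"] r by auto
    let ?d = "\<lambda>t. s * (?y t - z t)"
    have dV: "?d \<in> ?V" using s by (intro luxemburg_scale_le luxemburg_triangle_diff yV z)
    have "luxemburg E ?d \<le> s * luxemburg E (\<lambda>t. ?y t - z t)"
      using s by (intro luxemburg_scale_le luxemburg_triangle_diff yV z)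
    also have "\<dots> < s * (r / 4)" using z(3) s by (rule mult_strict_left_mono)
    finally have "luxemburg E ?d < r * s / 4" by (simp add: mult.commute)
    moreover have "(\<lambda>t. y t - ?d t) = (\<lambda>t. s * z t)" using s by (auto simp: field_simps)
    then have "L2_norm M (\<lambda>t. y t - ?d t) \<le> real k * s"
      using z(2) s by (simp add: L2_norm_scale mult.commute)
    ultimately show ?thesis using dV by blast
  qed
  have "L2_norm M y \<le> 2 * real k" if y: "y \<in> ?V" "luxemburg E y < r" for y
  proof -
    \<comment> \<open>\<open>w n\<close> will be the remainder after \<open>n\<close>
      approximations. The clause for \<open>n = 0\<close> fixes the start, so the differences
      telescope to \<open>y - w n\<close>.\<close>
    define P where "P n u \<longleftrightarrow> u \<in> ?V \<and> luxemburg E u < r * (1/4) ^ n \<and> (n = 0 \<longrightarrow> u = y)"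
      for n :: nat and u
    define Q where "Q n u v \<longleftrightarrow> L2_norm M (\<lambda>t. u t - v t) \<le> real k * (1/4) ^ n"
      for n :: nat and u v
    have "\<exists>w. \<forall>n. P n (w n) \<and> Q n (w n) (w (Suc n))"
    proof (rule dependent_nat_choice)
      show "\<exists>u. P 0 u" using y by (auto simp: P_def)
      fix u n assume "P n u"
      then show "\<exists>v. P (Suc n) v \<and> Q n u v"
        using approx[of u "(1/4) ^ n"] by (auto simp: P_def Q_def)
    qed
    then obtain w where w: "\<And>n. P n (w n)" "\<And>n. Q n (w n) (w (Suc n))" by blast
    have w0: "w 0 = y" and wV: "w n \<in> ?V" and wr: "luxemburg E (w n) < r * (1/4) ^ n" for n
      using w(1)[of 0] w(1)[of n] by (auto simp: P_def)
    note wL = wV[THEN modular_space_L2] and yL = y(1)[THEN modular_space_L2]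
    define z where "z n = (\<lambda>t. w n t - w (Suc n) t)" for n
    have zL: "z n \<in> L2 M" for n unfolding z_def by (intro L2_diff wL)
    have zk: "L2_norm M (z n) \<le> real k * (1/4) ^ n" for n
      using w(2)[of n] by (simp add: Q_def z_def)
    have partial: "(\<Sum>i<n. z i t) = y t - w n t" for n t
      by (induction n) (auto simp: w0 z_def)
    obtain s where s: "s \<in> L2 M" "(\<lambda>n. L2_norm M (\<lambda>t. s t - (\<Sum>i<n. z i t))) \<longlonglongrightarrow> 0"
      "L2_norm M s \<le> 2 * real k"
      using L2_geometric_series[OF zL zk] .
    \<comment> \<open>The remainders tend to 0 in the Luxemburg seminorm and to \<open>y - s\<close>
      in L2. Lower semicontinuity applied to \<open>w n / e\<close> for every \<open>e\<close> gives
      \<open>y - s\<close> seminorm 0, whence \<open>y = s\<close> almost everywhere.\<close>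
    have small: "E (\<lambda>t. (y t - s t) / e) \<le> 1" if e: "e > 0" for e
    proof (rule E_le_of_L2_limit[of "\<lambda>n t. w n t / e"])
      have "(\<lambda>n. \<bar>1 / e\<bar> * L2_norm M (\<lambda>t. s t - (\<Sum>i<n. z i t))) \<longlonglongrightarrow> \<bar>1 / e\<bar> * 0"
        by (intro tendsto_intros s)
      moreover have "(\<lambda>t. w n t / e - (y t - s t) / e) = (\<lambda>t. 1 / e * (s t - (\<Sum>i<n. z i t)))" for n
        by (auto simp: partial diff_divide_distrib add_divide_distrib)
      ultimately show "(\<lambda>n. L2_norm M (\<lambda>t. w n t / e - (y t - s t) / e)) \<longlonglongrightarrow> 0"
        by (simp only: L2_norm_scale mult_zero_right)
      have "(\<lambda>n. r * (1/4) ^ n) \<longlonglongrightarrow> 0"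
        by (intro tendsto_mult_right_zero LIMSEQ_realpow_zero) auto
      then have "\<forall>\<^sub>F n in sequentially. r * (1/4) ^ n < e"
        using e by (rule order_tendstoD(2))
      then show "\<forall>\<^sub>F n in sequentially. E (\<lambda>t. w n t / e) \<le> 1"
      proof eventually_elim
        case (elim n)
        then show ?case using wr[of n] by (intro luxemburg_lessD(2)[OF wV]) simp
      qed
    qed (intro L2_divide L2_diff wL yL s)+
    have dV: "(\<lambda>t. y t - s t) \<in> ?V"
      using small[of 1] by (intro modular_space_finite L2_diff yL s)
        (auto intro: le_less_trans[OF _ ennreal_one_less_top])
    have "luxemburg E (\<lambda>t. y t - s t) \<le> 0"
      using luxemburg_le[OF _ small] by (rule_tac field_le_epsilon) simp
    then have "luxemburg E (\<lambda>t. y t - s t) = 0"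
      using luxemburg_nonneg[OF dV] by simp
    then have "AE t in M. y t - s t = 0"
      using banach dV unfolding modular_banach_def by blast
    then have "AE t in M. (y t)\<^sup>2 = (s t)\<^sup>2" by eventually_elim simp
    then have "L2_norm M y = L2_norm M s"
      unfolding L2_norm_def using yL s(1)
      by (intro arg_cong[where f = sqrt] integral_cong_AE)
        (auto dest!: L2_square_integrable borel_measurable_integrable)
    then show ?thesis using s(3) by simp
  qed
  with r show thesis by (intro that) auto
qed

text \<open>For \<open>b\<close> at least 1 and \<open>c\<close>, convexity gives
  \<open>E (f / b) <= 1\<close>, so the Luxemburg seminorm of \<open>f\<close> is at most
  \<open>b\<close>. The factor \<open>r / (2 * b)\<close> then moves \<open>f\<close> strictly
  inside the ball where the L2 norm is controlled.\<close>

lemma sublevel_L2_bounded: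
  assumes banach: "modular_banach M E" and c: "c < \<infinity>"
  obtains R where "\<And>f. f \<in> L2 M \<Longrightarrow> E f \<le> c \<Longrightarrow> L2_norm M f \<le> R"
proof -
  obtain r K where r: "r > 0"
    and K: "\<forall>y\<in>modular_space M E. luxemburg E y < r \<longrightarrow> L2_norm M y \<le> K"
    using modular_embedding_bounded[OF banach] .
  obtain b where b: "b \<ge> 1" "c \<le> ennreal b"
  proof -
    obtain a where "c = ennreal a" using c by (cases c) auto
    then show thesis by (intro that[of "max 1 a"]) (auto intro: ennreal_leI)
  qed
  have "L2_norm M f \<le> K / (r / (2 * b))" if f: "f \<in> L2 M" "E f \<le> c" for f
  proof -
    have fV: "f \<in> modular_space M E"
      using f c by (intro modular_space_finite) (auto intro: le_less_trans)
    have "E (\<lambda>x. 1 / b * f x) \<le> ennreal (1 / b) * E f"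
      using b f by (intro E_scale_le) auto
    also have "\<dots> \<le> ennreal (1 / b) * ennreal b"
      using f(2) b(2) by (intro mult_left_mono) auto
    also have "\<dots> = 1" using b by (simp flip: ennreal_mult)
    finally have "luxemburg E f \<le> b" using b by (intro luxemburg_le) auto
    moreover have s: "r / (2 * b) > 0" using r b by simp
    ultimately have "luxemburg E (\<lambda>x. r / (2 * b) * f x) \<le> r / (2 * b) * b"
      using luxemburg_scale_le(2)[OF fV s] mult_left_mono[of "luxemburg E f" b "r / (2 * b)"]
      by simp
    also have "\<dots> < r" using r b by simp
    finally have "L2_norm M (\<lambda>x. r / (2 * b) * f x) \<le> K"
      using luxemburg_scale_le(1)[OF fV s] by (intro K[rule_format])
    then have "r / (2 * b) * L2_norm M f \<le> K" using s by (simp only: L2_norm_scale abs_of_pos)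
    then show ?thesis
      using s by (subst pos_le_divide_eq) (simp_all only: mult.commute)
  qed
  then show thesis by (rule that)
qed

text \<open>L2 bounds on sublevel sets put a merely measurable limit into L2, so semicontinuity
  holds on all of L0 and not only on \<open>dom_E M E\<close>.\<close>

lemma lsc_L0_ext_L0:
  assumes "modular_banach M E"
  shows "lsc_L0 M (ext_L0 M E)"
  unfolding lsc_L0_def
proof (intro allI impI)
  fix fs f
  assume f: "f \<in> borel_measurable M" and conv: "loc_meas_conv M fs f"
  show "ext_L0 M E f \<le> liminf (\<lambda>n. ext_L0 M E (fs n))"
  proof (rule ext_L0_le_liminf[OF conv])
    fix r :: "nat \<Rightarrow> nat" and c
    assume c: "c < \<infinity>" and fs: "\<And>n. fs (r n) \<in> L2 M" "\<And>n. E (fs (r n)) \<le> c"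
      and lim: "AE x in M. (\<lambda>n. fs (r n) x) \<longlonglongrightarrow> f x"
    obtain R where R: "\<And>f. f \<in> L2 M \<Longrightarrow> E f \<le> c \<Longrightarrow> L2_norm M f \<le> R"
      using sublevel_L2_bounded[OF assms c] by blast
    show "f \<in> L2 M \<and> E f \<le> c"
      using E_le_of_AE_limit_bounded[where fs = "\<lambda>n. fs (r n)", OF fs(1) f lim R[OF fs] fs(2)]
      by blast
  qed
qed

section \<open>Nonlinear Dirichlet forms\<close>

text \<open>The contraction \<open>abs\<close> applied to half the difference, with half the sum as
  the other argument, produces maximum and minimum.\<close>

lemma dirichlet_lattice:
  assumes dir: "nonlinear_dirichlet_form M E" and f: "f \<in> L2 M" and g: "g \<in> L2 M"
  shows "E (\<lambda>x. max (f x) (g x)) + E (\<lambda>x. min (f x) (g x)) \<le> E f + E g"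
proof -
  have "normal_contraction abs"
    by (auto simp: normal_contraction_def abs_triangle_ineq3)
  then have op: "operates_on M abs E" using dir by (simp add: nonlinear_dirichlet_form_def)
  let ?u = "\<lambda>x. (f x + g x) / 2" and ?v = "\<lambda>x. (f x - g x) / 2"
  have "?u \<in> L2 M" "?v \<in> L2 M" by (intro L2_divide L2_add L2_diff f g)+
  then have "E (\<lambda>x. ?u x + \<bar>?v x\<bar>) + E (\<lambda>x. ?u x - \<bar>?v x\<bar>)
      \<le> E (\<lambda>x. ?u x + ?v x) + E (\<lambda>x. ?u x - ?v x)"
    by (rule op[unfolded operates_on_def, rule_format])
  moreover have "(\<lambda>x. ?u x + \<bar>?v x\<bar>) = (\<lambda>x. max (f x) (g x))"
    "(\<lambda>x. ?u x - \<bar>?v x\<bar>) = (\<lambda>x. min (f x) (g x))"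
    by (auto simp: max_def min_def abs_if field_simps)
  moreover have "(\<lambda>x. ?u x + ?v x) = f" "(\<lambda>x. ?u x - ?v x) = g"
    by (auto simp: field_simps)
  ultimately show ?thesis by simp
qed

lemma L2_max_min:
  assumes "f \<in> L2 M" "g \<in> L2 M"
  shows "(\<lambda>x. max (f x) (g x)) \<in> L2 M" "(\<lambda>x. min (f x) (g x)) \<in> L2 M"
proof -
  have L: "(\<lambda>x. \<bar>f x\<bar> + \<bar>g x\<bar>) \<in> L2 M" by (intro L2_add L2_abs assms)
  show "(\<lambda>x. max (f x) (g x)) \<in> L2 M" "(\<lambda>x. min (f x) (g x)) \<in> L2 M"
    by (rule L2_dominated[OF L]; use assms[THEN L2_measurable] in auto)+
qed

lemma E_le_of_AE_limit_dirichlet: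
  assumes dir: "nonlinear_dirichlet_form M E"
    and fs: "\<And>n. fs n \<in> L2 M" and f: "f \<in> L2 M" "E f < \<infinity>"
    and lim: "AE x in M. (\<lambda>n. fs n x) \<longlonglongrightarrow> f x"
    and c: "\<And>n. E (fs n) \<le> c" "c < \<infinity>"
  shows "E f \<le> c"
proof (rule ennreal_le_epsilon)
  fix e :: real assume e: "e > 0"
  define I where "I = (INF h\<in>{h \<in> L2 M. \<forall>x. \<bar>f x\<bar> \<le> h x}. E h)"
  have I_le: "I \<le> E h" if "h \<in> L2 M" "\<And>x. \<bar>f x\<bar> \<le> h x" for h
    unfolding I_def using that by (intro INF_lower) auto
  \<comment> \<open>The lattice inequality for \<open>f\<close> and \<open>- f\<close> shows that
    the majorant \<open>|f|\<close> has finite energy. Thus \<open>I\<close> is finite and an almost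
    minimal \<open>g\<close> exists.\<close>
  have "(\<lambda>x. max (f x) (- f x)) = (\<lambda>x. \<bar>f x\<bar>)" by (auto simp: fun_eq_iff)
  then have "E (\<lambda>x. \<bar>f x\<bar>) \<le> E (\<lambda>x. max (f x) (- f x)) + E (\<lambda>x. min (f x) (- f x))"
    by simp
  also have "\<dots> \<le> E f + E (\<lambda>x. - f x)" by (intro dirichlet_lattice dir f L2_minus)
  also have "\<dots> < \<infinity>" using f by (simp add: symmetric)
  finally have "I < \<infinity>"
    using I_le[OF L2_abs[OF f(1)]] by (auto intro: le_less_trans)
  then have "I < I + ennreal (e / 2)"
    using e ennreal_add_left_cancel_less[of I 0 "ennreal (e / 2)"] by simp
  then obtain g where g: "g \<in> L2 M" "\<And>x. \<bar>f x\<bar> \<le> g x" "E g < I + ennreal (e / 2)"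
    unfolding I_def by (auto simp: INF_less_iff)
  have g0: "0 \<le> g x" for x using g(2)[of x] by linarith
  have g_fin: "E g < \<infinity>" using g(3) by (rule less_le_trans) simp
  \<comment> \<open>Whatever lies above \<^term>\<open>g\<close> has almost at least the energy of \<^term>\<open>g\<close>, so by the lattice
    inequality cutting off at \<^term>\<open>g\<close> raises the energy by at most \<^term>\<open>e / 2\<close>.\<close>
  have cut: "E (\<lambda>x. min (h x) (g x)) \<le> E h + ennreal (e / 2)"
    if h: "h \<in> L2 M" "E h < \<infinity>" for h
  proof -
    let ?m = "E (\<lambda>x. max (h x) (g x))"
    have "I \<le> ?m" using g(2) by (intro I_le L2_max_min h g) (simp add: le_max_iff_disj)
    then have Eg: "E g \<le> ?m + ennreal (e / 2)"
      using g(3) by (meson add_right_mono less_imp_le order_trans)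
    have lat: "?m + E (\<lambda>x. min (h x) (g x)) \<le> E h + E g"
      by (intro dirichlet_lattice dir h g)
    also have "\<dots> < \<infinity>" using h g_fin by simp
    \<comment> \<open>Finiteness permits cancelling \<open>?m\<close> from both sides in
      \<open>ennreal\<close>.\<close>
    finally have fin: "?m \<noteq> \<infinity>" by auto
    have "?m + E (\<lambda>x. min (h x) (g x)) \<le> E h + (?m + ennreal (e / 2))"
      using lat Eg by (meson add_left_mono order_trans)
    then have "?m + E (\<lambda>x. min (h x) (g x)) \<le> ?m + (E h + ennreal (e / 2))"
      by (simp add: ac_simps)
    then show ?thesis using fin by (simp add: ennreal_add_left_cancel_le)
  qed
  define u where "u n x = max (min (fs n x) (g x)) (- g x)" for n x
  have minL: "(\<lambda>x. min (fs n x) (g x)) \<in> L2 M" for n by (intro L2_max_min fs g)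
  have uL: "u n \<in> L2 M" for n unfolding u_def by (intro L2_max_min minL L2_minus g)
  have "E (u n) \<le> c + ennreal e" for n
  proof -
    let ?h = "\<lambda>x. min (fs n x) (g x)"
    have fin: "E (fs n) < \<infinity>" using c by (rule le_less_trans)
    note 1 = cut[OF fs fin]
    also have "E (fs n) + ennreal (e / 2) < \<infinity>" using fin by simp
    finally have "E (\<lambda>x. - ?h x) < \<infinity>" using symmetric[OF minL[of n]] by simp
    note 2 = cut[OF L2_minus[OF minL] this]
    \<comment> \<open>The lower truncation is an upper truncation of the negative, so symmetry lets
      \<open>cut\<close> be used a second time.\<close>
    have eq: "(\<lambda>x. - u n x) = (\<lambda>x. min (- ?h x) (g x))"
      by (auto simp: u_def fun_eq_iff)
    have "E (u n) = E (\<lambda>x. - u n x)" by (rule symmetric[OF uL, symmetric])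
    also have "\<dots> \<le> E ?h + ennreal (e / 2)"
      using 2 symmetric[OF minL[of n]] by (simp only: eq)
    also have "\<dots> \<le> (E (fs n) + ennreal (e / 2)) + ennreal (e / 2)"
      using 1 by (rule add_right_mono)
    also have "\<dots> = E (fs n) + ennreal e"
      using e by (simp add: add.assoc flip: ennreal_plus)
    also have "\<dots> \<le> c + ennreal e" using c(1) by (rule add_right_mono)
    finally show ?thesis .
  qed
  moreover have "(\<lambda>n. L2_norm M (\<lambda>x. u n x - f x)) \<longlonglongrightarrow> 0"
  proof (rule L2_norm_dominated_convergence[OF uL f(1) g(1)])
    show "AE x in M. (\<lambda>n. u n x) \<longlonglongrightarrow> f x"
      using lim
    proof eventually_elim
      case (elim x)
      have "(\<lambda>n. u n x) \<longlonglongrightarrow> max (min (f x) (g x)) (- g x)"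
        unfolding u_def by (intro tendsto_intros elim)
      moreover have "max (min (f x) (g x)) (- g x) = f x" using g(2)[of x] by linarith
      ultimately show ?case by simp
    qed
    show "\<bar>u n x\<bar> \<le> g x" for n x using g0[of x] by (auto simp: u_def)
  qed (rule g(2))
  ultimately show "E f \<le> c + ennreal e"
    by (intro E_le_of_L2_limit[OF uL f(1)]) simp_all
qed

end

section \<open>Existence of the extended functional in both cases\<close>

theorem theorem3p6:
  fixes M :: "'a measure" and E :: "('a \<Rightarrow> real) \<Rightarrow> ennreal"
  assumes "sigma_finite_measure M"
    and "respects_ae M E"
    and "lsc_L2 M E"
    and "convex_L2 M E"
    and "\<forall>f\<in>L2 M. E (\<lambda>x. - f x) = E f"
    and "E (\<lambda>x. 0) = 0"
    and "modular_banach M E \<or> nonlinear_dirichlet_form M E"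
  shows "E_e_exists M E \<and>
    (modular_banach M E \<longrightarrow>
       (\<forall>f\<in>borel_measurable M. relaxation_L0 M (ext_L0 M E) f = ext_L0 M E f))"
proof -
  interpret symmetric_convex_functional M E
    using assms by unfold_locales auto
  have "E_e_exists M E" if "modular_banach M E"
    using lsc_L0_ext_L0[OF that] by (auto simp: E_e_exists_def lsc_L0_def dom_E_def L2_measurable)
  \<comment> \<open>Here the limit has finite energy by assumption, which supplies the majorant
    behind the truncation.\<close>
  moreover have "E_e_exists M E" if dir: "nonlinear_dirichlet_form M E"
    unfolding E_e_exists_def
  proof (intro allI impI)
    fix fs f
    assume f: "f \<in> dom_E M E" and conv: "loc_meas_conv M fs f"
    show "ext_L0 M E f \<le> liminf (\<lambda>n. ext_L0 M E (fs n))"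
    proof (rule ext_L0_le_liminf[OF conv])
      fix r :: "nat \<Rightarrow> nat" and c
      assume "c < \<infinity>" "\<And>n. fs (r n) \<in> L2 M" "\<And>n. E (fs (r n)) \<le> c"
        "AE x in M. (\<lambda>n. fs (r n) x) \<longlonglongrightarrow> f x"
      then show "f \<in> L2 M \<and> E f \<le> c"
        using f E_le_of_AE_limit_dirichlet[OF dir, of "\<lambda>n. fs (r n)" f c] by (simp add: dom_E_def)
    qed
  qed
  ultimately show ?thesis
    using assms(7) relaxation_L0_eq[OF lsc_L0_ext_L0] by blast
qed

end
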